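(* Let $\Phi=(C_n,\varphi)$ be a $\mathbb{T}$-gain digraph on the directed cycle $v_1\to v_2\to\cdots\to v_n\to v_1$. If $g=\varphi(C_n)=\prod_{i=1}^{n}\varphi(v_i,v_{i+1})$ (with $v_{n+1}=v_1$), then $\operatorname{spec}(A(\Phi))=\{\lambda\in\mathbb{C}:\lambda^n=g\}$ and $\rho(\Phi)=1$.
   Context: $C_n$ ($n\ge2$) is the digraph with distinct vertices $v_1,\dots,v_n$ and exactly the arcs $(v_i,v_{i+1})$, $1\le i\le n$, indices mod $n$. Let $\mathbb{T}=\{z\in\mathbb{C}:|z|=1\}$. A $\mathbb{T}$-gain digraph on a digraph $D$ is a pair $\Phi=(D,\varphi)$ where $\varphi$ assigns to each arc of $D$ an element of $\mathbb{T}$, arbitrarily. Its gain adjacency matrix $A(\Phi)$ has entries $A(\Phi)_{ij}=\varphi(v_i,v_j)$ if $(v_i,v_j)$ is an arc and $0$ otherwise. $\operatorname{spec}(M)$ is the multiset of complex eigenvalues of $M$ (here each of the $n$ roots occurs once), and $\rho(\Phi)$ is the spectral radius (maximum modulus of an eigenvalue) of $A(\Phi)$. *)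

theory Defs
  imports
    "Graph_Theory.Pair_Digraph"
    "Jordan_Normal_Form.Spectral_Radius"
begin

type_synonym 'a gain_digraph = "'a pair_pre_digraph \<times> ('a \<times> 'a \<Rightarrow> complex)"

definition unit_circle :: "complex set" where
  "unit_circle = {z. cmod z = 1}"

text \<open>The gain function is total on pairs of vertices; its values outside the arcs are
  unconstrained and never used.\<close>

definition is_gain_digraph :: "'a gain_digraph \<Rightarrow> bool" where
  "is_gain_digraph \<Phi> \<longleftrightarrow>
     pair_fin_digraph (fst \<Phi>) \<and> (\<forall>e \<in> parcs (fst \<Phi>). snd \<Phi> e \<in> unit_circle)"

text \<open>The vertices are listed as \<open>v 1, \<dots>, v n\<close>, whereas matrix indices start at 0; hence
  the shift by \<open>Suc\<close>.\<close>

definition gain_adjacency :: "nat \<Rightarrow> (nat \<Rightarrow> 'a) \<Rightarrow> 'a gain_digraph \<Rightarrow> complex mat" where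
  "gain_adjacency n v \<Phi> = mat n n (\<lambda>(i, j).
     if (v (Suc i), v (Suc j)) \<in> parcs (fst \<Phi>) then snd \<Phi> (v (Suc i), v (Suc j)) else 0)"

text \<open>For \<open>1 \<le> i \<le> n\<close>, the index \<open>i mod n + 1\<close> is \<open>i + 1\<close> if \<open>i < n\<close>, and \<open>1\<close> if \<open>i = n\<close>.\<close>

definition directed_cycle :: "nat \<Rightarrow> (nat \<Rightarrow> 'a) \<Rightarrow> 'a pair_pre_digraph" where
  "directed_cycle n v =
     \<lparr> pverts = v ` {1..n}, parcs = {(v i, v (i mod n + 1)) | i. i \<in> {1..n}} \<rparr>"

definition cycle_gain :: "nat \<Rightarrow> (nat \<Rightarrow> 'a) \<Rightarrow> 'a gain_digraph \<Rightarrow> complex" where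
  "cycle_gain n v \<Phi> = (\<Prod>i = 1..n. snd \<Phi> (v i, v (i mod n + 1)))"

text \<open>Eigenvalues with algebraic multiplicity.\<close>

definition spec :: "complex mat \<Rightarrow> complex multiset" where
  "spec M = proots (char_poly M)"

lemma pair_digraph_directed_cycle:
  assumes n: "n \<ge> 2" and inj: "inj_on v {1..n}"
  shows "pair_digraph (directed_cycle n v)"
proof
  have succ: "i mod n + 1 \<in> {1..n}" for i
    using n by (simp add: Suc_le_eq)
  show "fst e \<in> pverts (directed_cycle n v)"
    "snd e \<in> pverts (directed_cycle n v)"
    if "e \<in> parcs (directed_cycle n v)" for e
    using that succ by (auto simp: directed_cycle_def)
  show "finite (pverts (directed_cycle n v))" "finite (parcs (directed_cycle n v))"
    by (auto simp: directed_cycle_def)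
  show "fst e \<noteq> snd e" if e: "e \<in> parcs (directed_cycle n v)" for e
  proof
    assume eq: "fst e = snd e"
    from e obtain i where i: "i \<in> {1..n}" "e = (v i, v (i mod n + 1))"
      by (auto simp: directed_cycle_def)
    with eq have "v i = v (i mod n + 1)" by simp
    with inj i succ have "i = i mod n + 1" by (meson inj_onD)
    with i n show False by (cases "i = n") auto
  qed
qed

end

theory Submission
  imports Defs
begin

text \<open>Rescaling the coordinates by the partial gain products shows that every \<open>n\<close>-th root of
  \<open>g\<close> is an eigenvalue. There are \<open>n\<close> such roots and the characteristic polynomial has degree
  \<open>n\<close>, so they are all its roots and each of them is simple.\<close>

lemma proots_eq_mset_set:
  assumes "p \<noteq> 0" "finite S" "\<And>z. z \<in> S \<Longrightarrow> poly p z = 0" "card S = degree p"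
  shows "proots p = mset_set S"
proof -
  \<comment> \<open>Every element of \<open>S\<close> has order at least 1 in \<open>p\<close>, and
    \<open>mset_set\<close> counts it exactly once.\<close>
  have "mset_set S \<subseteq># proots p"
    using assms(1-3) by (auto simp: mset_subset_eqI subseteq_mset_def count_mset_set' Suc_le_eq order_root)
  moreover have "size (proots p) \<le> size (mset_set S)"
    using assms(4) size_proots_le[of p] by simp
  ultimately show ?thesis
    by (metis mset_subset_size subset_mset.order_iff_strict not_le)
qed

text \<open>\<open>spectral_radius\<close> is a maximum over the set \<open>spectrum\<close>; this
  carries the multiset result over to it.\<close>

lemma spectrum_eq_set_mset_spec:
  assumes "A \<in> carrier_mat n n"
  shows "spectrum A = set_mset (spec A)"
proof -
  have "char_poly A \<noteq> 0"
    using degree_monic_char_poly[OF assms] by auto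
  then show ?thesis
    by (simp add: spec_def spectrum_root_char_poly[OF assms])
qed

text \<open>Injectivity of \<open>v\<close> turns equality of vertices into equality of indices, so
  the matrix is a weighted cyclic shift. With indices from 0, the cyclic successor of
  \<open>i\<close> is \<open>Suc i mod n\<close>.\<close>

lemma gain_adjacency_cycle:
  assumes "inj_on v {1..n}" "i < n" "j < n"
  shows "gain_adjacency n v (directed_cycle n v, \<phi>) $$ (i, j) =
    (if j = Suc i mod n then \<phi> (v (Suc i), v (Suc j)) else 0)"
proof -
  have "v k = v (Suc i) \<longleftrightarrow> k = Suc i" "v (Suc j) = v (Suc (k mod n)) \<longleftrightarrow> j = k mod n"
    if "k \<in> {1..n}" for k
    using that assms by (auto simp: inj_on_eq_iff Suc_le_eq)
  then have "(v (Suc i), v (Suc j)) \<in> parcs (directed_cycle n v) \<longleftrightarrow> j = Suc i mod n"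
    using assms(2) by (auto simp: directed_cycle_def Suc_le_eq)
      (metis Suc_leI le_0_eq atLeastAtMost_iff le_add1 plus_1_eq_Suc)+
  then show ?thesis
    using assms by (simp add: gain_adjacency_def)
qed

lemma eigenvalue_gain_adjacency_cycle:
  assumes "n > 0" "inj_on v {1..n}"
    and nz: "\<And>i. i \<in> {1..n} \<Longrightarrow> \<phi> (v i, v (i mod n + 1)) \<noteq> 0"
    and z: "z ^ n = cycle_gain n v (directed_cycle n v, \<phi>)"
  shows "eigenvalue (gain_adjacency n v (directed_cycle n v, \<phi>)) z"
proof -
  let ?A = "gain_adjacency n v (directed_cycle n v, \<phi>)"
  define c where "c i = \<phi> (v i, v (i mod n + 1))" for i
  \<comment> \<open>This solves the eigenvector recursion
    \<open>c (Suc i) * x (Suc i) = z * x i\<close> from \<open>x 0 = 1\<close>.\<close>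
  define x where "x i = z ^ i / (\<Prod>k = 1..i. c k)" for i
  have x_Suc: "c (Suc i) * x (Suc i) = z * x i" if "i < n" for i
    using nz[of "Suc i"] that by (simp add: x_def c_def)
  \<comment> \<open>The hypothesis on \<open>z\<close> enters here: \<open>x n = x 0\<close>, so the
    recursion closes up around the cycle.\<close>
  have "x n = 1"
    using z nz by (simp add: x_def c_def cycle_gain_def)
  then have x_mod: "x (Suc i mod n) = x (Suc i)" if "i < n" for i
    using that by (cases "Suc i = n") (auto simp: x_def)
  have A: "?A \<in> carrier_mat n n"
    by (simp add: gain_adjacency_def)
  have "?A *\<^sub>v vec n x = z \<cdot>\<^sub>v vec n x"
  proof (rule eq_vecI)
    fix i assume "i < dim_vec (z \<cdot>\<^sub>v vec n x)"
    then have i: "i < n" by simp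
    have "(?A *\<^sub>v vec n x) $ i = (\<Sum>j<n. ?A $$ (i, j) * x j)"
      using A i by (simp add: scalar_prod_def lessThan_atLeast0)
    also have "\<dots> = (\<Sum>j<n. if j = Suc i mod n then c (Suc i) * x (Suc i) else 0)"
      using i x_mod by (intro sum.cong) (auto simp: gain_adjacency_cycle[OF assms(2)] c_def)
    also have "\<dots> = z * x i"
      using i x_Suc by (simp add: sum.delta)
    finally show "(?A *\<^sub>v vec n x) $ i = (z \<cdot>\<^sub>v vec n x) $ i"
      using i by simp
  qed (use A in auto)
  \<comment> \<open>Entry 0 is \<open>z ^ 0\<close> over an empty product, that is 1.\<close>
  moreover have "vec n x \<noteq> 0\<^sub>v n"
  proof
    assume "vec n x = 0\<^sub>v n"
    then have "vec n x $ 0 = 0\<^sub>v n $ 0" by simp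
    then show False
      using assms(1) by (simp add: x_def)
  qed
  ultimately show ?thesis
    using A unfolding eigenvalue_def eigenvector_def
    by (intro exI[of _ "vec n x"]) simp
qed

theorem theorem4p1:
  fixes n :: nat and v :: "nat \<Rightarrow> 'a" and \<phi> :: "'a \<times> 'a \<Rightarrow> complex"
    and \<Phi> :: "'a gain_digraph" and g :: complex
  assumes "n \<ge> 2"
    and "inj_on v {1..n}"
    and "\<Phi> = (directed_cycle n v, \<phi>)"
    and "is_gain_digraph \<Phi>"
    and "g = cycle_gain n v \<Phi>"
  shows "spec (gain_adjacency n v \<Phi>) = mset_set {z. z ^ n = g} \<and>
         spectral_radius (gain_adjacency n v \<Phi>) = 1"
proof
  let ?A = "gain_adjacency n v \<Phi>" and ?S = "{z. z ^ n = g}"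
  have n: "n > 0" using assms(1) by simp
  have A: "?A \<in> carrier_mat n n"
    by (simp add: gain_adjacency_def)
  have norm: "cmod (\<phi> (v i, v (i mod n + 1))) = 1" if "i \<in> {1..n}" for i
    using assms(3,4) that
    by (auto simp: is_gain_digraph_def directed_cycle_def unit_circle_def)
  have g: "cmod g = 1"
    using assms(3,5) norm by (simp add: cycle_gain_def prod_norm[symmetric])
  \<comment> \<open>For nonzero \<open>g\<close> the \<open>n\<close>-th roots are pairwise
    distinct, which makes their number exactly \<open>n\<close>.\<close>
  then have "g \<noteq> 0" by auto
  then have card: "card ?S = n"
    using card_nth_roots n by blast
  \<comment> \<open>As \<open>card\<close> is 0 on infinite sets, positive cardinality gives
    finiteness.\<close>
  have fin: "finite ?S"
    using card n card_ge_0_finite by metis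
  have "poly (char_poly ?A) z = 0" if "z \<in> ?S" for z
  proof -
    have "eigenvalue ?A z"
      unfolding assms(3)
      by (rule eigenvalue_gain_adjacency_cycle) (use n assms that norm in fastforce)+
    then show ?thesis
      by (simp add: eigenvalue_root_char_poly[OF A])
  qed
  moreover have "char_poly ?A \<noteq> 0" "degree (char_poly ?A) = n"
    using degree_monic_char_poly[OF A] by auto
  ultimately show spec: "spec ?A = mset_set ?S"
    unfolding spec_def using card fin by (intro proots_eq_mset_set) auto
  have "cmod z = 1" if "z \<in> ?S" for z
  proof -
    have "cmod z ^ n = 1"
      using that g by (simp flip: norm_power)
    then show ?thesis
      using n power_eq_imp_eq_base[of "cmod z" n 1] by simp
  qed
  \<comment> \<open>Without an element, the set of moduli would be empty instead of
    \<open>{1}\<close>.\<close>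
  moreover have "?S \<noteq> {}"
    using card n by (metis card.empty less_irrefl)
  ultimately have "cmod ` ?S = {1}"
    by force
  moreover have "spectrum ?A = ?S"
    using spectrum_eq_set_mset_spec[OF A] spec fin by simp
  ultimately show "spectral_radius ?A = 1"
    by (simp add: spectral_radius_def)
qed

end
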